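(* Let $\mathrm{W}$ be a twice continuously differentiable elastic energy, written as a function of the Green-Lagrange strain $E=\tfrac12(F^TF-\mathbb 1)$, with second Piola-Kirchhoff stress $S_2(E)=\mathrm{D}_E\mathrm{W}(E)\in\mathrm{Sym}(3)$ and Cauchy stress $\sigma=J^{-1}F\,S_2(E)\,F^T$, $J=\det F$. Let $\mathbb C=\mathrm{D}_ES_2(E)$ be the material elasticity tensor and let $\mathbb c$ be the spatial elasticity tensor, with components $$\mathbb c_{ijkl}=J^{-1}F_{iI}F_{jJ}\,\mathbb C_{IJKL}\,F_{kK}F_{lL}.$$ Then for every motion, $$\frac{\mathrm{D}^{\mathrm{ZJ}}}{\mathrm{D}t}[\sigma]=\mathbb H^{\mathrm{ZJ}}(\sigma).D,\qquad \mathbb H^{\mathrm{ZJ}}(\sigma)=\mathbb c+\mathbb 1\,\overline{\underline{\otimes}}\,\sigma+\sigma\,\overline{\underline{\otimes}}\,\mathbb 1-\sigma\otimes\mathbb 1,$$ that is, in Cartesian components, $$[\mathbb H^{\mathrm{ZJ}}(\sigma)]_{ijkl}=\mathbb c_{ijkl}+\tfrac12(\delta_{ik}\sigma_{jl}+\sigma_{il}\delta_{jk})+\tfrac12(\sigma_{ik}\delta_{jl}+\delta_{il}\sigma_{jk})-\sigma_{ij}\delta_{kl}.$$ Moreover, the fourth-order tensor $\mathbb H^{\mathrm{ZJ}}(\sigma)$ so defined possesses both minor symmetries, and it does not possess the major symmetry unless $\sigma$ is hydrostatic (i.e. $\sigma$ is a scalar multiple of $\mathbb 1$).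
   Context: $\mathrm{Sym}(3)$ is the space of real symmetric $3\times3$ matrices, $\mathbb 1$ is the identity matrix with components $\delta_{ij}$. Cartesian coordinates and the summation convention over repeated indices are used. The energy $\mathrm{W}$ is defined on the open set of $E\in\mathrm{Sym}(3)$ with $\mathbb 1+2E$ positive definite; $\mathrm{D}_E$ denotes the Fréchet derivative with respect to $E$. The tensor $\mathbb C=\mathrm{D}_ES_2(E)$, a linear map on $\mathrm{Sym}(3)$, is identified with the fourth-order tensor $\mathbb C_{IJKL}$ having both minor symmetries (i.e. it is extended to all $3\times3$ matrices by $\mathbb C.X=\mathbb C.\tfrac12(X+X^T)$). A motion is represented at a material point by a $C^1$ curve $t\mapsto F(t)$ of real $3\times3$ matrices with $\det F(t)>0$; a dot or $\frac{\mathrm D}{\mathrm Dt}$ denotes the derivative along the curve. $L=\dot F F^{-1}$, $D=\tfrac12(L+L^T)$, $W=\tfrac12(L-L^T)$ (not to be confused with the energy $\mathrm W$). The Zaremba-Jaumann rate of $\sigma$ is $\frac{\mathrm{D}^{\mathrm{ZJ}}}{\mathrm{D}t}[\sigma]=\frac{\mathrm D}{\mathrm Dt}[\sigma]+\sigma W-W\sigma$. The action of a fourth-order tensor is $(\mathbb T.Z)_{ij}=\mathbb T_{ijkl}Z_{kl}$. For second-order tensors $P,Q$, $$(P\otimes Q)_{ijkl}=P_{ij}Q_{kl},\qquad (P\,\overline{\underline{\otimes}}\,Q)_{ijkl}=\tfrac12\,(P_{ik}Q_{jl}+Q_{il}P_{jk}).$$ Minor symmetries of $\mathbb T$: $\mathbb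 T_{ijkl}=\mathbb T_{jikl}$ (left) and $\mathbb T_{ijkl}=\mathbb T_{ijlk}$ (right). Major symmetry: $\mathbb T_{ijkl}=\mathbb T_{klij}$. *)

theory Defs
  imports "HOL-Analysis.Analysis"
begin

type_synonym mat3 = "real^3^3"
type_synonym tensor4 = "real^3^3^3^3"

subsection \<open>Fourth-order tensors\<close>

definition kdelta :: "3 \<Rightarrow> 3 \<Rightarrow> real" where
  "kdelta i j = (if i = j then 1 else 0)"

definition tensor_app :: "tensor4 \<Rightarrow> mat3 \<Rightarrow> mat3" (infixl "\<bullet>\<^sub>4" 75) where
  "T \<bullet>\<^sub>4 Z = (\<chi> i j. \<Sum>k\<in>UNIV. \<Sum>l\<in>UNIV. T $ i $ j $ k $ l * Z $ k $ l)"

definition tensor_prod :: "mat3 \<Rightarrow> mat3 \<Rightarrow> tensor4" where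
  "tensor_prod P Q = (\<chi> i j k l. P $ i $ j * Q $ k $ l)"

definition sym_tensor_prod :: "mat3 \<Rightarrow> mat3 \<Rightarrow> tensor4" where
  "sym_tensor_prod P Q =
     (\<chi> i j k l. (1/2) * (P $ i $ k * Q $ j $ l + Q $ i $ l * P $ j $ k))"

definition left_minor_symmetric :: "tensor4 \<Rightarrow> bool" where
  "left_minor_symmetric T \<longleftrightarrow> (\<forall>i j k l. T $ i $ j $ k $ l = T $ j $ i $ k $ l)"

definition right_minor_symmetric :: "tensor4 \<Rightarrow> bool" where
  "right_minor_symmetric T \<longleftrightarrow> (\<forall>i j k l. T $ i $ j $ k $ l = T $ i $ j $ l $ k)"

definition major_symmetric :: "tensor4 \<Rightarrow> bool" where
  "major_symmetric T \<longleftrightarrow> (\<forall>i j k l. T $ i $ j $ k $ l = T $ k $ l $ i $ j)"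

subsection \<open>Strains and the elastic energy\<close>

definition Sym3 :: "mat3 set" where
  "Sym3 = {A. transpose A = A}"

definition positive_definite :: "mat3 \<Rightarrow> bool" where
  "positive_definite A \<longleftrightarrow> A \<in> Sym3 \<and> (\<forall>x. x \<noteq> 0 \<longrightarrow> x \<bullet> (A *v x) > 0)"

definition strains :: "mat3 set" where
  "strains = {E \<in> Sym3. positive_definite (mat 1 + 2 *\<^sub>R E)}"

definition green_lagrange :: "mat3 \<Rightarrow> mat3" where
  "green_lagrange F = (1/2) *\<^sub>R (transpose F ** F - mat 1)"

text \<open>
  An energy is a total function on matrices of which only the values on \<^const>\<open>strains\<close>, a
  relatively open subset of \<^const>\<open>Sym3\<close>, matter; hence all derivatives are taken within
  \<^const>\<open>strains\<close>. Such a derivative is determined only on \<^const>\<open>Sym3\<close>. It becomes unique by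
  requiring the gradient (for the Frobenius inner product, which is the inner product of the
  matrix type) to be symmetric and the elasticity tensor to have the minor symmetries.
\<close>

definition second_piola :: "(mat3 \<Rightarrow> real) \<Rightarrow> mat3 \<Rightarrow> mat3" where
  "second_piola W E =
     (THE S. S \<in> Sym3 \<and> (W has_derivative (\<lambda>H. S \<bullet> H)) (at E within strains))"

definition material_elasticity :: "(mat3 \<Rightarrow> real) \<Rightarrow> mat3 \<Rightarrow> tensor4" where
  "material_elasticity W E =
     (THE C. left_minor_symmetric C \<and> right_minor_symmetric C \<and>
        (second_piola W has_derivative (\<lambda>H. C \<bullet>\<^sub>4 H)) (at E within strains))"

definition C2_energy :: "(mat3 \<Rightarrow> real) \<Rightarrow> bool" where
  "C2_energy W \<longleftrightarrow>
     W differentiable_on strains \<and>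
     second_piola W differentiable_on strains \<and>
     continuous_on strains (material_elasticity W)"

definition cauchy_stress :: "(mat3 \<Rightarrow> real) \<Rightarrow> mat3 \<Rightarrow> mat3" where
  "cauchy_stress W F =
     (1 / det F) *\<^sub>R (F ** second_piola W (green_lagrange F) ** transpose F)"

definition spatial_elasticity :: "(mat3 \<Rightarrow> real) \<Rightarrow> mat3 \<Rightarrow> tensor4" where
  "spatial_elasticity W F =
     (\<chi> i j k l. (1 / det F) *
        (\<Sum>I\<in>UNIV. \<Sum>J\<in>UNIV. \<Sum>K\<in>UNIV. \<Sum>L\<in>UNIV.
           F $ i $ I * F $ j $ J * material_elasticity W (green_lagrange F) $ I $ J $ K $ L
             * F $ k $ K * F $ l $ L))"

definition H_ZJ :: "(mat3 \<Rightarrow> real) \<Rightarrow> mat3 \<Rightarrow> tensor4" where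
  "H_ZJ W F =
     spatial_elasticity W F
     + sym_tensor_prod (mat 1) (cauchy_stress W F)
     + sym_tensor_prod (cauchy_stress W F) (mat 1)
     - tensor_prod (cauchy_stress W F) (mat 1)"

definition hydrostatic :: "mat3 \<Rightarrow> bool" where
  "hydrostatic \<sigma> \<longleftrightarrow> (\<exists>p. \<sigma> = p *\<^sub>R mat 1)"

subsection \<open>Motions and the Zaremba-Jaumann rate\<close>

text \<open>The time interval \<open>I\<close> may or may not contain its end points, where derivatives are one-sided.\<close>

definition motion_on :: "real set \<Rightarrow> (real \<Rightarrow> mat3) \<Rightarrow> bool" where
  "motion_on I F \<longleftrightarrow>
     is_interval I \<and> interior I \<noteq> {} \<and>
     (\<exists>F'. continuous_on I F' \<and> (\<forall>t\<in>I. (F has_vector_derivative F' t) (at t within I))) \<and>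
     (\<forall>t\<in>I. det (F t) > 0)"

definition velocity_gradient :: "real set \<Rightarrow> (real \<Rightarrow> mat3) \<Rightarrow> real \<Rightarrow> mat3" where
  "velocity_gradient I F t = vector_derivative F (at t within I) ** matrix_inv (F t)"

definition stretching :: "real set \<Rightarrow> (real \<Rightarrow> mat3) \<Rightarrow> real \<Rightarrow> mat3" where
  "stretching I F t =
     (1/2) *\<^sub>R (velocity_gradient I F t + transpose (velocity_gradient I F t))"

definition spin :: "real set \<Rightarrow> (real \<Rightarrow> mat3) \<Rightarrow> real \<Rightarrow> mat3" where
  "spin I F t =
     (1/2) *\<^sub>R (velocity_gradient I F t - transpose (velocity_gradient I F t))"

definition ZJ_rate :: "real set \<Rightarrow> (real \<Rightarrow> mat3) \<Rightarrow> (real \<Rightarrow> mat3) \<Rightarrow> real \<Rightarrow> mat3" where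
  "ZJ_rate I F \<sigma> t =
     vector_derivative \<sigma> (at t within I) + \<sigma> t ** spin I F t - spin I F t ** \<sigma> t"

end

(*
  Every strain has a neighbourhood in Sym(3) consisting of strains, so derivatives within the
  strains are determined on symmetric matrices, and the symmetrised gradient and elasticity tensor
  are the unique ones with the prescribed symmetries. Differentiating sigma = J^-1 F S F^T with
  F' = L F, (det F)' = tr L det F and E' = F^T D F gives
  sigma' = c.D + L sigma + sigma L^T - (tr D) sigma; adding sigma W - W sigma replaces L by D.
  The second-order difference quotient of the energy is symmetric in its two directions, so C, and
  with it c, has the major symmetry. Hence H is major symmetric iff sigma (x) 1 is, and comparing
  the components ij and 11 forces sigma to be hydrostatic.
*)
theory Submission
  imports Defs
begin

subsection \<open>Symmetry of second derivatives\<close>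

text \<open>The mean value theorem in direction \<open>h\<close> turns the second difference into
  \<open>t\<close> times an increment of \<open>S\<close> across \<open>t *\<^sub>R k\<close>,
  paired with \<open>h\<close>. Both points are within O(\<open>t\<close>) of \<open>x\<close>, so
  differentiability of \<open>S\<close> at \<open>x\<close> gives this increment up to
  o(\<open>t\<close>).\<close>

lemma difference_quotient_tendsto:
  fixes f :: "'a::real_inner \<Rightarrow> real" and S :: "'a \<Rightarrow> 'a"
  assumes f: "\<And>x. x \<in> U \<Longrightarrow> (f has_derivative (\<lambda>h. S x \<bullet> h)) (at x within U)"
    and S: "(S has_derivative T) (at x within U)"
    and e: "e > 0"
    and U: "\<And>s t. \<bar>s\<bar> < e \<Longrightarrow> \<bar>t\<bar> < e \<Longrightarrow> x + s *\<^sub>R h + t *\<^sub>R k \<in> U"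
  shows "((\<lambda>t. (f (x + t *\<^sub>R h + t *\<^sub>R k) - f (x + t *\<^sub>R h) - f (x + t *\<^sub>R k) + f x) / t\<^sup>2)
           \<longlongrightarrow> T k \<bullet> h) (at_right 0)"
proof (rule tendstoI)
  fix \<epsilon> :: real assume "\<epsilon> > 0"
  \<comment> \<open>The final error is \<open>\<eta> * (M - 1)\<close>; the summand 1 makes
    \<open>M\<close> positive and the last estimate strict.\<close>
  define M where "M = (2 * (norm h + norm k)) * norm h + 1"
  have M: "M > 0" unfolding M_def by (intro add_nonneg_pos add_nonneg_nonneg mult_nonneg_nonneg) auto
  define \<eta> where "\<eta> = \<epsilon> / M"
  have "\<eta> > 0" using M \<open>\<epsilon> > 0\<close> by (simp add: \<eta>_def)
  interpret T: bounded_linear T by (rule has_derivative_bounded_linear[OF S])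
  obtain d where d: "d > 0"
    and bound: "\<And>y. y \<in> U \<Longrightarrow> norm (y - x) < d \<Longrightarrow>
                  norm (S y - S x - T (y - x)) \<le> \<eta> * norm (y - x)"
    using S \<open>\<eta> > 0\<close> unfolding has_derivative_within_alt by blast
  \<comment> \<open>The bound \<open>e\<close> keeps the parallelogram in \<open>U\<close>, the
    other keeps its points within \<open>d\<close> of \<open>x\<close>.\<close>
  define r where "r = min e (d / (norm h + norm k + 1))"
  have nhk: "norm h + norm k + 1 > 0" by (intro add_nonneg_pos add_nonneg_nonneg) auto
  have r: "r > 0" using e d nhk by (simp add: r_def)
  let ?\<Delta> = "\<lambda>t. f (x + t *\<^sub>R h + t *\<^sub>R k) - f (x + t *\<^sub>R h) - f (x + t *\<^sub>R k) + f x"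
  have "dist (?\<Delta> t / t\<^sup>2) (T k \<bullet> h) < \<epsilon>" if t: "0 < t" "t < r" for t
  proof -
    have te: "t < e" using t by (simp add: r_def)
    \<comment> \<open>The offset \<open>c\<close> will be \<open>t\<close> and \<open>0\<close>,
      giving two opposite sides of the parallelogram.\<close>
    have line: "((\<lambda>s. f (x + s *\<^sub>R h + c *\<^sub>R k)) has_derivative
                  (\<lambda>v. S (x + s *\<^sub>R h + c *\<^sub>R k) \<bullet> (v *\<^sub>R h))) (at s within {0..t})"
      if s: "s \<in> {0..t}" and c: "\<bar>c\<bar> < e" for s c
    proof (rule has_derivative_in_compose2[where g = f and t = U and g' = "\<lambda>y v. S y \<bullet> v"])
      show "(\<lambda>s. x + s *\<^sub>R h + c *\<^sub>R k) ` {0..t} \<subseteq> U"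
        using U te c by auto
    qed (use f s in \<open>auto intro!: derivative_eq_intros\<close>)
    \<comment> \<open>Mean value theorem in direction \<open>h\<close>, applied to the increment of \<open>f\<close> in direction \<open>k\<close>.\<close>
    let ?\<phi> = "\<lambda>s. f (x + s *\<^sub>R h + t *\<^sub>R k) - f (x + s *\<^sub>R h)"
    have "(?\<phi> has_derivative
            (\<lambda>v. S (x + s *\<^sub>R h + t *\<^sub>R k) \<bullet> (v *\<^sub>R h) - S (x + s *\<^sub>R h) \<bullet> (v *\<^sub>R h))) (at s within {0..t})"
      if "0 \<le> s" "s \<le> t" for s
      using that has_derivative_diff[OF line[of s t] line[of s 0]] te e t by simp
    then obtain \<xi> where \<xi>: "\<xi> \<in> {0<..<t}" and
      mv: "?\<phi> t - ?\<phi> 0 = S (x + \<xi> *\<^sub>R h + t *\<^sub>R k) \<bullet> ((t - 0) *\<^sub>R h) - S (x + \<xi> *\<^sub>R h) \<bullet> ((t - 0) *\<^sub>R h)"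
      using mvt_simple[OF t(1), of ?\<phi> "\<lambda>s v. S (x + s *\<^sub>R h + t *\<^sub>R k) \<bullet> (v *\<^sub>R h) - S (x + s *\<^sub>R h) \<bullet> (v *\<^sub>R h)"]
      by blast
    define y where "y = x + \<xi> *\<^sub>R h + t *\<^sub>R k"
    define z where "z = x + \<xi> *\<^sub>R h"
    have yz: "y \<in> U" "z \<in> U"
      using U[of \<xi> t] U[of \<xi> 0] te \<xi> e by (auto simp: y_def z_def)
    have rd: "t * (norm h + norm k + 1) < d"
      using t(2) nhk by (simp add: r_def field_simps)
    have h1: "norm (\<xi> *\<^sub>R h) \<le> t * norm h" using \<xi> by (auto intro: mult_right_mono)
    have ny: "norm (y - x) \<le> t * (norm h + norm k)"
      unfolding y_def using h1 t norm_triangle_ineq[of "\<xi> *\<^sub>R h" "t *\<^sub>R k"]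
      by (simp add: algebra_simps)
    have nz: "norm (z - x) \<le> t * (norm h + norm k)"
      unfolding z_def using h1 t by (simp add: algebra_simps add_increasing2)
    have "t * (norm h + norm k) < d" using rd t by (simp add: algebra_simps)
    then have by1: "norm (S y - S x - T (y - x)) \<le> \<eta> * (t * (norm h + norm k))"
      and bz1: "norm (S z - S x - T (z - x)) \<le> \<eta> * (t * (norm h + norm k))"
      using bound[OF yz(1)] bound[OF yz(2)] ny nz \<open>\<eta> > 0\<close>
      by (meson le_less_trans mult_left_mono order_trans less_imp_le)+
    \<comment> \<open>As \<open>y - z = t *\<^sub>R k\<close>, the linear parts combine to
      \<open>t *\<^sub>R T k\<close> and only two first-order remainders are left.\<close>
    have eq: "S y - S z - t *\<^sub>R T k = (S y - S x - T (y - x)) - (S z - S x - T (z - x))"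
      by (simp add: y_def z_def T.add T.diff T.scaleR algebra_simps)
    have "norm (S y - S z - t *\<^sub>R T k) \<le> 2 * (\<eta> * (t * (norm h + norm k)))"
      unfolding eq by (rule order_trans[OF norm_triangle_ineq4]) (use by1 bz1 in linarith)
    then have b: "\<bar>(S y - S z - t *\<^sub>R T k) \<bullet> h\<bar> \<le> 2 * (\<eta> * (t * (norm h + norm k))) * norm h"
      by (meson Cauchy_Schwarz_ineq2 mult_right_mono norm_ge_zero order_trans)
    have \<Delta>: "?\<Delta> t = t * ((S y - S z) \<bullet> h)"
      using mv by (simp add: y_def z_def inner_diff_left algebra_simps)
    have "?\<Delta> t / t\<^sup>2 - T k \<bullet> h = ((S y - S z - t *\<^sub>R T k) \<bullet> h) / t"
      unfolding \<Delta> using t by (simp add: power2_eq_square inner_diff_left diff_divide_distrib)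
    then have "\<bar>?\<Delta> t / t\<^sup>2 - T k \<bullet> h\<bar> = \<bar>(S y - S z - t *\<^sub>R T k) \<bullet> h\<bar> / t"
      using t by (simp only: abs_divide abs_of_pos)
    also have "\<dots> \<le> 2 * (\<eta> * (t * (norm h + norm k))) * norm h / t"
      using b t by (intro divide_right_mono) auto
    also have "\<dots> = \<eta> * (M - 1)" using t by (simp add: M_def)
    also have "\<dots> < \<epsilon>" using M \<open>\<epsilon> > 0\<close> by (simp add: \<eta>_def field_simps)
    finally show ?thesis by (simp add: dist_real_def)
  qed
  then show "\<forall>\<^sub>F t in at_right 0. dist (?\<Delta> t / t\<^sup>2) (T k \<bullet> h) < \<epsilon>"
    using r unfolding eventually_at_right_field by blast
qed

text \<open>The second difference is unchanged when \<open>h\<close> and \<open>k\<close> are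
  exchanged, so its two limits coincide. Asking for a small parallelogram inside \<open>U\<close>
  suits \<open>strains\<close>, which is open only relative to a subspace.\<close>

lemma derivative_of_gradient_symmetric:
  fixes f :: "'a::real_inner \<Rightarrow> real" and S :: "'a \<Rightarrow> 'a"
  assumes f: "\<And>x. x \<in> U \<Longrightarrow> (f has_derivative (\<lambda>h. S x \<bullet> h)) (at x within U)"
    and S: "(S has_derivative T) (at x within U)"
    and e: "e > 0"
    and U: "\<And>s t. \<bar>s\<bar> < e \<Longrightarrow> \<bar>t\<bar> < e \<Longrightarrow> x + s *\<^sub>R h + t *\<^sub>R k \<in> U"
  shows "T k \<bullet> h = T h \<bullet> k"
proof (rule tendsto_unique)
  show "((\<lambda>t. (f (x + t *\<^sub>R h + t *\<^sub>R k) - f (x + t *\<^sub>R h) - f (x + t *\<^sub>R k) + f x) / t\<^sup>2)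
           \<longlongrightarrow> T k \<bullet> h) (at_right 0)"
    by (rule difference_quotient_tendsto[OF assms])
  have "((\<lambda>t. (f (x + t *\<^sub>R k + t *\<^sub>R h) - f (x + t *\<^sub>R k) - f (x + t *\<^sub>R h) + f x) / t\<^sup>2)
           \<longlongrightarrow> T h \<bullet> k) (at_right 0)"
    using U by (intro difference_quotient_tendsto[OF f S e]) (auto simp: add.assoc add.commute[of "_ *\<^sub>R k"])
  then show "((\<lambda>t. (f (x + t *\<^sub>R h + t *\<^sub>R k) - f (x + t *\<^sub>R h) - f (x + t *\<^sub>R k) + f x) / t\<^sup>2)
           \<longlongrightarrow> T h \<bullet> k) (at_right 0)"
    by (simp add: algebra_simps)
qed auto

subsection \<open>Symmetric matrices and strains\<close>

text \<open>The orthogonal projection onto \<open>Sym3\<close> for the Frobenius inner product. It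
  extends derivatives, determined only on \<open>Sym3\<close>, to all matrices.\<close>

definition sym_part :: "mat3 \<Rightarrow> mat3" where
  "sym_part A = (1/2) *\<^sub>R (A + transpose A)"

lemma transpose_simps:
  fixes A B :: "real^'n^'m"
  shows "transpose (A + B) = transpose A + transpose B"
    "transpose (A - B) = transpose A - transpose B"
    "transpose (c *\<^sub>R A) = c *\<^sub>R transpose A"
  by (simp_all add: transpose_def vec_eq_iff)

lemma inner_matrix_eq: "A \<bullet> B = (\<Sum>i\<in>UNIV. \<Sum>j\<in>UNIV. A $ i $ j * B $ i $ j)"
  for A B :: "real^'n^'m"
  by (simp add: inner_vec_def)

lemma inner_transpose: "transpose A \<bullet> B = A \<bullet> transpose B" for A :: "real^'n^'m"
  unfolding inner_matrix_eq transpose_def by (subst sum.swap) simp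

lemma sym_part_in_Sym3 [simp]: "sym_part A \<in> Sym3"
  by (simp add: sym_part_def Sym3_def transpose_simps add.commute)

lemma sym_part_Sym3: "A \<in> Sym3 \<Longrightarrow> sym_part A = A"
  by (simp add: sym_part_def Sym3_def vec_eq_iff)

lemma linear_sym_part: "linear sym_part"
  by (rule linearI) (simp_all add: sym_part_def transpose_simps algebra_simps)

lemmas bounded_linear_sym_part = linear_sym_part[unfolded linear_conv_bounded_linear]

lemma inner_sym_part: "A \<bullet> sym_part B = sym_part A \<bullet> B"
  by (simp add: sym_part_def inner_add_left inner_add_right inner_transpose)

section \<open>Derivatives within the strains\<close>

lemma strains_subset_Sym3: "strains \<subseteq> Sym3"
  by (auto simp: strains_def)

text \<open>\<open>sym_part\<close> fixes every strain, so composing \<open>f\<close> with it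
  changes nothing on \<open>strains\<close>, while the chain rule precomposes the derivative with
  the projection.\<close>

lemma has_derivative_strains_sym_part:
  assumes "(f has_derivative f') (at E within strains)" "E \<in> strains"
  shows "(f has_derivative (\<lambda>H. f' (sym_part H))) (at E within strains)"
proof -
  have id: "sym_part X = X" if "X \<in> strains" for X
    using that strains_subset_Sym3 sym_part_Sym3 by auto
  have "((\<lambda>X. f (sym_part X)) has_derivative (\<lambda>H. f' (sym_part H))) (at E within strains)"
    by (rule has_derivative_in_compose[OF bounded_linear_imp_has_derivative[OF bounded_linear_sym_part]])
       (simp add: assms id cong: image_cong)
  then show ?thesis
    by (rule has_derivative_transform[OF assms(2) id[symmetric, THEN arg_cong], rotated])
qed

text \<open>By compactness the quadratic form of \<open>mat 1 + 2 *\<^sub>R E\<close> has a positive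
  minimum on the unit sphere, and a small symmetric perturbation cannot cancel it.\<close>

lemma strains_relatively_open:
  assumes E: "E \<in> strains"
  obtains e where "e > 0" "\<And>X. X \<in> Sym3 \<Longrightarrow> norm (X - E) < e \<Longrightarrow> X \<in> strains"
proof -
  define A where "A = mat 1 + 2 *\<^sub>R E"
  have A: "A \<in> Sym3" "\<And>x. x \<noteq> 0 \<Longrightarrow> x \<bullet> (A *v x) > 0" and ES: "E \<in> Sym3"
    using E by (auto simp: strains_def positive_definite_def A_def)
  \<comment> \<open>The sphere is nonempty, as attainment of the minimum requires.\<close>
  have "axis 1 1 \<in> sphere (0::real^3) 1" by (simp add: norm_axis_1)
  then have "\<exists>m \<in> sphere (0::real^3) 1. \<forall>x\<in>sphere 0 1. m \<bullet> (A *v m) \<le> x \<bullet> (A *v x)"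
    by (intro continuous_attains_inf continuous_intros
        linear_continuous_on matrix_vector_mul_bounded_linear) auto
  then obtain m where m: "m \<in> sphere (0::real^3) 1" "\<And>x. norm x = 1 \<Longrightarrow> m \<bullet> (A *v m) \<le> x \<bullet> (A *v x)"
    by auto
  define q where "q = m \<bullet> (A *v m)"
  have "m \<noteq> 0" using m by auto
  then have q: "q > 0" using A by (simp add: q_def)
  \<comment> \<open>In 18 = 2 * 9, the 2 is the factor of the strain in
    \<open>mat 1 + 2 *\<^sub>R X\<close>, and 9 counts the matrix entries in the bound of the
    operator norm.\<close>
  have "X \<in> strains" if X: "X \<in> Sym3" "norm (X - E) < q / 18" for X
  proof -
    have eq: "mat 1 + 2 *\<^sub>R X = A + 2 *\<^sub>R (X - E)" by (simp add: A_def algebra_simps)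
    have "x \<bullet> ((mat 1 + 2 *\<^sub>R X) *v x) > 0" if "x \<noteq> 0" for x
    proof -
      define u where "u = x /\<^sub>R norm x"
      have u: "norm u = 1" "x = norm x *\<^sub>R u" using that by (auto simp: u_def)
      have "onorm ((*v) (X - E)) \<le> 9 * norm (X - E)"
        using onorm_le_matrix_component[of "X - E" "norm (X - E)"]
          order_trans[OF component_le_norm_cart Finite_Cartesian_Product.norm_nth_le, of "X - E"] by simp
      then have "norm ((X - E) *v u) \<le> 9 * norm (X - E)"
        using onorm[OF matrix_vector_mul_bounded_linear, of "X - E" u] u by simp
      then have "\<bar>u \<bullet> ((X - E) *v u)\<bar> \<le> 9 * norm (X - E)"
        using Cauchy_Schwarz_ineq2[of u "(X - E) *v u"] u by simp
      then have "2 * (u \<bullet> ((X - E) *v u)) > - q" using X by simp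
      moreover have "u \<bullet> (A *v u) \<ge> q" using m u by (simp add: q_def)
      ultimately have "u \<bullet> ((mat 1 + 2 *\<^sub>R X) *v u) > 0"
        unfolding eq by (simp add: matrix_vector_mult_add_rdistrib inner_add_right scaleR_matrix_vector_assoc[symmetric])
      \<comment> \<open>Quadratic homogeneity carries positivity from the unit vector
        \<open>u\<close> to \<open>x\<close>.\<close>
      then have "(norm x * norm x) * (u \<bullet> ((mat 1 + 2 *\<^sub>R X) *v u)) > 0" using that by simp
      also have "(norm x * norm x) * (u \<bullet> ((mat 1 + 2 *\<^sub>R X) *v u)) = x \<bullet> ((mat 1 + 2 *\<^sub>R X) *v x)"
        using arg_cong[OF u(2), of "\<lambda>v. v \<bullet> ((mat 1 + 2 *\<^sub>R X) *v v)"] by (simp add: matrix_vector_mult_scaleR)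
      finally show ?thesis .
    qed
    moreover have "mat 1 + 2 *\<^sub>R X \<in> Sym3"
      using X by (simp add: Sym3_def transpose_simps transpose_mat)
    ultimately show ?thesis using X by (simp add: strains_def positive_definite_def)
  qed
  then show thesis using that[of "q / 18"] q by auto
qed

text \<open>Openness in \<open>Sym3\<close> supplies the parallelogram that
  \<open>derivative_of_gradient_symmetric\<close> asks for.\<close>

lemma strains_plane:
  assumes E: "E \<in> strains" and HK: "H \<in> Sym3" "K \<in> Sym3"
  obtains e where "e > 0" "\<And>s t. \<bar>s\<bar> < e \<Longrightarrow> \<bar>t\<bar> < e \<Longrightarrow> E + s *\<^sub>R H + t *\<^sub>R K \<in> strains"
proof -
  obtain r where r: "r > 0" "\<And>X. X \<in> Sym3 \<Longrightarrow> norm (X - E) < r \<Longrightarrow> X \<in> strains"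
    using strains_relatively_open[OF E] by blast
  define N where "N = norm H + norm K + 1"
  have N: "N > 0" unfolding N_def by (intro add_nonneg_pos add_nonneg_nonneg) auto
  show thesis
  proof (rule that[of "r / N"])
    fix s t :: real assume st: "\<bar>s\<bar> < r / N" "\<bar>t\<bar> < r / N"
    have "norm (s *\<^sub>R H + t *\<^sub>R K) \<le> \<bar>s\<bar> * norm H + \<bar>t\<bar> * norm K"
      using norm_triangle_ineq[of "s *\<^sub>R H" "t *\<^sub>R K"] by simp
    also have "\<dots> \<le> r / N * norm H + r / N * norm K"
      using st by (intro add_mono mult_right_mono) auto
    also have "\<dots> < r / N * N" using r N by (simp add: N_def distrib_left[symmetric] del: times_divide_eq_left)
    finally have "norm (s *\<^sub>R H + t *\<^sub>R K) < r" using N by simp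
    moreover have "E + s *\<^sub>R H + t *\<^sub>R K \<in> Sym3"
      using E HK strains_subset_Sym3 by (auto simp: Sym3_def transpose_simps)
    ultimately show "E + s *\<^sub>R H + t *\<^sub>R K \<in> strains"
      by (intro r(2)) (simp_all add: add.assoc)
  qed (use r N in simp)
qed

text \<open>For symmetric \<open>H\<close> the line \<open>E + s *\<^sub>R H\<close> stays in
  \<open>strains\<close> for small \<open>s\<close>, which reduces the claim to uniqueness of the
  derivative of a function of one real variable.\<close>

lemma has_derivative_strains_unique:
  fixes f :: "mat3 \<Rightarrow> 'b::real_normed_vector"
  assumes E: "E \<in> strains" and H: "H \<in> Sym3"
    and f: "(f has_derivative f') (at E within strains)" "(f has_derivative f'') (at E within strains)"
  shows "f' H = f'' H"
proof -
  obtain e where e: "e > 0" "\<And>s t. \<bar>s\<bar> < e \<Longrightarrow> \<bar>t\<bar> < e \<Longrightarrow> E + s *\<^sub>R H + t *\<^sub>R H \<in> strains"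
    using strains_plane[OF E H H] by metis
  let ?p = "\<lambda>s::real. E + s *\<^sub>R H"
  have sub: "?p ` ball 0 e \<subseteq> strains" using e(2)[where t = 0] e(1) by auto
  have line: "((\<lambda>s. f (?p s)) has_derivative (\<lambda>v. g (v *\<^sub>R H))) (at 0)"
    if "(f has_derivative g) (at E within strains)" for g
  proof -
    have "((\<lambda>s. f (?p s)) has_derivative (\<lambda>v. g (v *\<^sub>R H))) (at 0 within ball 0 e)"
    proof (rule has_derivative_in_compose[where g = f])
      show "(f has_derivative g) (at (?p 0) within ?p ` ball 0 e)"
        using has_derivative_subset[OF that sub] by simp
    qed (auto intro!: derivative_eq_intros)
    then show ?thesis using e(1) by (simp add: at_within_open[of 0 "ball 0 e"])
  qed
  from has_derivative_unique[OF line[OF f(1)] line[OF f(2)]] show ?thesis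
    by (metis scaleR_one)
qed

lemma Sym3_iff: "A \<in> Sym3 \<longleftrightarrow> (\<forall>i j. A $ i $ j = A $ j $ i)"
  by (auto simp: Sym3_def transpose_def vec_eq_iff)

lemma Sym3_nth: "A \<in> Sym3 \<Longrightarrow> A $ i $ j = A $ j $ i"
  unfolding Sym3_iff by blast

subsection \<open>Stress and material elasticity tensor\<close>

lemma linear_functional_inner:
  fixes f :: "'a::euclidean_space \<Rightarrow> real"
  assumes "linear f"
  obtains a where "f = (\<lambda>h. a \<bullet> h)"
proof
  show "f = (\<lambda>h. adjoint f 1 \<bullet> h)"
    using adjoint_works[OF assms, of _ 1] by (auto simp: inner_commute)
qed

text \<open>Justifies the definite description: some matrix represents the derivative as an inner
  product, and its symmetric part does so within \<open>strains\<close>; uniqueness holds because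
  the derivative is determined on \<open>Sym3\<close>.\<close>

lemma second_piola:
  assumes W: "W differentiable_on strains" and E: "E \<in> strains"
  shows "second_piola W E \<in> Sym3"
    and "(W has_derivative (\<lambda>H. second_piola W E \<bullet> H)) (at E within strains)"
proof -
  let ?P = "\<lambda>S. S \<in> Sym3 \<and> (W has_derivative (\<lambda>H. S \<bullet> H)) (at E within strains)"
  have "\<exists>!S. ?P S"
  proof (rule ex_ex1I)
    obtain f' where f': "(W has_derivative f') (at E within strains)"
      using W E by (auto simp: differentiable_on_def differentiable_def)
    obtain a where "f' = (\<lambda>h. a \<bullet> h)"
      using linear_functional_inner has_derivative_linear[OF f'] by blast
    then have "?P (sym_part a)"
      using has_derivative_strains_sym_part[OF f' E] by (simp add: inner_sym_part)
    then show "\<exists>S. ?P S" ..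
  next
    fix S S' assume S: "?P S" and S': "?P S'"
    \<comment> \<open>The difference is itself an admissible direction; testing with it shows that
      its norm vanishes.\<close>
    have "S - S' \<in> Sym3"
      using S S' by (simp add: Sym3_def transpose_simps)
    then have "S \<bullet> (S - S') = S' \<bullet> (S - S')"
      using S S' by (auto intro: has_derivative_strains_unique[OF E])
    then have "(S - S') \<bullet> (S - S') = 0" by (simp add: inner_diff_left)
    then show "S = S'" by simp
  qed
  from theI'[OF this] show "second_piola W E \<in> Sym3"
    and "(W has_derivative (\<lambda>H. second_piola W E \<bullet> H)) (at E within strains)"
    by (auto simp: second_piola_def)
qed

section \<open>Fourth-order tensors as linear maps, and the material elasticity tensor\<close>

definition unit_mat :: "3 \<Rightarrow> 3 \<Rightarrow> mat3" where
  "unit_mat k l = axis k (axis l 1)"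

lemma unit_mat_nth: "unit_mat k l $ i $ j = (if j = l then if i = k then 1 else 0 else 0)"
  by (auto simp: unit_mat_def axis_def)

lemma unit_mat_expansion: "Z = (\<Sum>k\<in>UNIV. \<Sum>l\<in>UNIV. Z $ k $ l *\<^sub>R unit_mat k l)"
  by (simp add: vec_eq_iff unit_mat_nth if_distrib[where f = "\<lambda>x. _ * x"] cong: if_cong)

lemma linear_unit_mat_expansion:
  assumes "linear f"
  shows "f Z = (\<Sum>k\<in>UNIV. \<Sum>l\<in>UNIV. Z $ k $ l *\<^sub>R f (unit_mat k l))"
  by (subst unit_mat_expansion) (simp add: linear_sum[OF assms] linear_scale[OF assms])

lemma linear_tensor_app: "linear (\<lambda>Z. T \<bullet>\<^sub>4 Z)"
  by (rule linearI)
     (simp_all add: tensor_app_def vec_eq_iff algebra_simps sum.distrib sum_distrib_left)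

lemma tensor_app_unit_mat: "(T \<bullet>\<^sub>4 unit_mat k l) $ i $ j = T $ i $ j $ k $ l"
  by (simp add: tensor_app_def unit_mat_nth if_distrib[where f = "\<lambda>x. _ * x"] cong: if_cong)

lemma tensor_eqI: "(\<And>Z. T \<bullet>\<^sub>4 Z = T' \<bullet>\<^sub>4 Z) \<Longrightarrow> T = T'"
  by (simp add: vec_eq_iff flip: tensor_app_unit_mat)

lemma tensor_app_transpose:
  assumes "right_minor_symmetric T"
  shows "T \<bullet>\<^sub>4 transpose Z = T \<bullet>\<^sub>4 Z"
proof -
  have r: "T $ i $ j $ k $ l = T $ i $ j $ l $ k" for i j k l
    using assms unfolding right_minor_symmetric_def by blast
  have "(\<Sum>k\<in>UNIV. \<Sum>l\<in>UNIV. T $ i $ j $ k $ l * Z $ l $ k) =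
     (\<Sum>k\<in>UNIV. \<Sum>l\<in>UNIV. T $ i $ j $ k $ l * Z $ k $ l)" for i j
    by (subst sum.swap, intro sum.cong refl) (subst r, rule refl)
  then show ?thesis by (simp add: tensor_app_def transpose_def vec_eq_iff)
qed

text \<open>Such a tensor cannot distinguish a matrix from its transpose, so it is determined by its
  action on \<open>Sym3\<close>.\<close>

lemma tensor_app_sym_part:
  assumes "right_minor_symmetric T"
  shows "T \<bullet>\<^sub>4 sym_part Z = T \<bullet>\<^sub>4 Z"
proof -
  have "T \<bullet>\<^sub>4 sym_part Z = (1/2) *\<^sub>R (T \<bullet>\<^sub>4 Z + T \<bullet>\<^sub>4 transpose Z)"
    by (simp only: sym_part_def linear_add[OF linear_tensor_app] linear_scale[OF linear_tensor_app])
  then show ?thesis by (simp only: tensor_app_transpose[OF assms] scaleR_half_double)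
qed

lemma tensor_app_in_Sym3: "left_minor_symmetric T \<Longrightarrow> T \<bullet>\<^sub>4 Z \<in> Sym3"
  unfolding Sym3_iff left_minor_symmetric_def tensor_app_def by simp

text \<open>Existence comes from symmetrising any derivative in its argument and in its value. Two
  candidates agree on \<open>Sym3\<close>, and right minor symmetry extends the agreement to all
  matrices.\<close>

lemma material_elasticity:
  assumes W: "W differentiable_on strains" and S: "second_piola W differentiable_on strains"
    and E: "E \<in> strains"
  shows "left_minor_symmetric (material_elasticity W E)"
    and "right_minor_symmetric (material_elasticity W E)"
    and "(second_piola W has_derivative (\<lambda>H. material_elasticity W E \<bullet>\<^sub>4 H)) (at E within strains)"
proof -
  let ?P = "\<lambda>C. left_minor_symmetric C \<and> right_minor_symmetric C \<and>
        (second_piola W has_derivative (\<lambda>H. C \<bullet>\<^sub>4 H)) (at E within strains)"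
  have "\<exists>!C. ?P C"
  proof (rule ex_ex1I)
    obtain g where g: "(second_piola W has_derivative g) (at E within strains)"
      using S E by (auto simp: differentiable_on_def differentiable_def)
    \<comment> \<open>The inner projection yields the right minor symmetry, the outer one the
      left.\<close>
    define h where "h H = sym_part (g (sym_part H))" for H
    \<comment> \<open>Stresses are symmetric on \<open>strains\<close>, so the projected derivative
      is still a derivative of the same function.\<close>
    have sym: "sym_part (second_piola W X) = second_piola W X" if "X \<in> strains" for X
      by (rule sym_part_Sym3[OF second_piola(1)[OF W that]])
    have "((\<lambda>X. sym_part (second_piola W X)) has_derivative (\<lambda>H. sym_part (g H))) (at E within strains)"
      by (rule bounded_linear.has_derivative[OF bounded_linear_sym_part g])
    then have "(second_piola W has_derivative (\<lambda>H. sym_part (g H))) (at E within strains)"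
      by (rule has_derivative_transform[OF E sym[symmetric], rotated])
    then have h: "(second_piola W has_derivative h) (at E within strains)"
      unfolding h_def by (rule has_derivative_strains_sym_part[OF _ E])
    define C :: tensor4 where "C = (\<chi> i j k l. h (unit_mat k l) $ i $ j)"
    have "C \<bullet>\<^sub>4 H = h H" for H
      by (subst linear_unit_mat_expansion[OF has_derivative_linear[OF h]])
         (simp add: C_def tensor_app_def vec_eq_iff mult.commute)
    moreover have "h H $ i $ j = h H $ j $ i" for H i j
      unfolding h_def by (rule Sym3_nth[OF sym_part_in_Sym3])
    then have "left_minor_symmetric C"
      unfolding left_minor_symmetric_def C_def by simp
    moreover have "sym_part (unit_mat k l) = sym_part (unit_mat l k)" for k l
      by (auto simp: sym_part_def vec_eq_iff transpose_def unit_mat_nth)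
    then have "right_minor_symmetric C"
      unfolding right_minor_symmetric_def C_def h_def by simp
    ultimately have "?P C" using h by simp
    then show "\<exists>C. ?P C" ..
  next
    fix C C' assume C: "?P C" and C': "?P C'"
    have "C \<bullet>\<^sub>4 sym_part Z = C' \<bullet>\<^sub>4 sym_part Z" for Z
      using C C' by (auto intro: has_derivative_strains_unique[OF E])
    then show "C = C'"
      using C C' by (intro tensor_eqI) (simp add: tensor_app_sym_part)
  qed
  from theI'[OF this] show "left_minor_symmetric (material_elasticity W E)"
    and "right_minor_symmetric (material_elasticity W E)"
    and "(second_piola W has_derivative (\<lambda>H. material_elasticity W E \<bullet>\<^sub>4 H)) (at E within strains)"
    by (auto simp: material_elasticity_def)
qed

text \<open>The stress is the gradient of \<open>W\<close>, so this is the symmetry of a second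
  derivative: the major symmetry of the elasticity tensor as a bilinear form.\<close>

lemma material_elasticity_symmetric:
  assumes W: "W differentiable_on strains" and S: "second_piola W differentiable_on strains"
    and E: "E \<in> strains"
  shows "(material_elasticity W E \<bullet>\<^sub>4 X) \<bullet> Y = (material_elasticity W E \<bullet>\<^sub>4 Y) \<bullet> X"
proof -
  let ?C = "material_elasticity W E"
  note C = material_elasticity[OF W S E]
  \<comment> \<open>Both arguments are reduced to symmetric ones, since small parallelograms stay in
    \<open>strains\<close> only in symmetric directions.\<close>
  have red: "(?C \<bullet>\<^sub>4 X) \<bullet> Y = (?C \<bullet>\<^sub>4 sym_part X) \<bullet> sym_part Y" for X Y
    by (simp add: inner_sym_part tensor_app_sym_part[OF C(2)] sym_part_Sym3 tensor_app_in_Sym3[OF C(1)])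
  obtain e where e: "e > 0" "\<And>s t. \<bar>s\<bar> < e \<Longrightarrow> \<bar>t\<bar> < e \<Longrightarrow>
      E + s *\<^sub>R sym_part Y + t *\<^sub>R sym_part X \<in> strains"
    using strains_plane[OF E sym_part_in_Sym3 sym_part_in_Sym3] by metis
  have "(?C \<bullet>\<^sub>4 sym_part X) \<bullet> sym_part Y = (?C \<bullet>\<^sub>4 sym_part Y) \<bullet> sym_part X"
    by (rule derivative_of_gradient_symmetric[OF second_piola(2)[OF W] C(3) e])
  then show ?thesis using red[of X Y] red[of Y X] by argo
qed

subsection \<open>Spatial elasticity tensor\<close>

lemma matrix_mult_nth: "(A ** B) $ i $ j = (\<Sum>k\<in>UNIV. A $ i $ k * B $ k $ j)"
  by (simp add: matrix_matrix_mult_def)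

lemma transpose_nth: "transpose A $ i $ j = A $ j $ i"
  by (simp add: transpose_def)

text \<open>The quadratic form of \<open>transpose F ** F\<close> at \<open>x\<close> is the squared
  norm of \<open>F *v x\<close>, positive for \<open>x \<noteq> 0\<close> because \<open>F\<close>
  is injective.\<close>

lemma green_lagrange_in_strains:
  assumes "det F \<noteq> 0"
  shows "green_lagrange F \<in> strains"
proof -
  have C: "mat 1 + 2 *\<^sub>R green_lagrange F = transpose F ** F"
    by (simp add: green_lagrange_def)
  have "x \<bullet> ((transpose F ** F) *v x) > 0" if "x \<noteq> 0" for x
  proof -
    have "x \<bullet> ((transpose F ** F) *v x) = (F *v x) \<bullet> (F *v x)"
      by (metis dot_lmul_matrix matrix_vector_mul_assoc transpose_matrix_vector transpose_transpose)
    moreover have "F *v x \<noteq> 0"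
      using that assms by (metis invertible_det_nz invertible_left_inverse matrix_left_invertible_ker)
    ultimately show ?thesis by simp
  qed
  then show ?thesis
    unfolding strains_def positive_definite_def C
    by (simp add: Sym3_def green_lagrange_def transpose_simps transpose_mat matrix_transpose_mul)
qed

lemma cauchy_stress_in_Sym3:
  assumes W: "W differentiable_on strains" and F: "det F \<noteq> 0"
  shows "cauchy_stress W F \<in> Sym3"
  using second_piola(1)[OF W green_lagrange_in_strains[OF F]]
  by (simp add: cauchy_stress_def Sym3_def transpose_simps matrix_transpose_mul matrix_mul_assoc)

text \<open>With $G^{ij}_{IJ} = F_{iI} F_{jJ}$ one has
  $J\,c_{ijkl} = (C.G^{kl}) : G^{ij}$, which turns the symmetries of $C$ into those of $c$.\<close>

definition pull_back_unit :: "mat3 \<Rightarrow> 3 \<Rightarrow> 3 \<Rightarrow> mat3" where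
  "pull_back_unit F i j = (\<chi> I J. F $ i $ I * F $ j $ J)"

lemma spatial_elasticity_inner:
  "spatial_elasticity W F $ i $ j $ k $ l = (1 / det F) *
     ((material_elasticity W (green_lagrange F) \<bullet>\<^sub>4 pull_back_unit F k l) \<bullet> pull_back_unit F i j)"
  by (simp add: spatial_elasticity_def inner_matrix_eq tensor_app_def pull_back_unit_def
      sum_distrib_left sum_distrib_right mult_ac)

lemma transpose_pull_back_unit: "transpose (pull_back_unit F i j) = pull_back_unit F j i"
  by (simp add: pull_back_unit_def transpose_def mult.commute)

lemma inner_pull_back_unit: "A \<bullet> pull_back_unit F i j = (F ** A ** transpose F) $ i $ j"
  by (simp add: inner_matrix_eq pull_back_unit_def matrix_mult_nth transpose_nth
      sum_3 algebra_simps)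

text \<open>\<open>pull_back_unit F k l\<close> equals
  \<open>transpose F ** unit_mat k l ** F\<close>, so the sum is the pull-back of \<open>Z\<close>
  expanded in matrix units.\<close>

lemma sum_pull_back_unit:
  "(\<Sum>k\<in>UNIV. \<Sum>l\<in>UNIV. Z $ k $ l *\<^sub>R pull_back_unit F k l) = transpose F ** Z ** F"
  by (simp add: vec_eq_iff pull_back_unit_def matrix_mult_nth transpose_nth sum_3 algebra_simps)

text \<open>Pull-back, material tensor and push-forward in succession: the form in which the spatial
  tensor emerges from the chain rule for the stress.\<close>

lemma spatial_elasticity_app:
  "spatial_elasticity W F \<bullet>\<^sub>4 Z = (1 / det F) *\<^sub>R
     (F ** (material_elasticity W (green_lagrange F) \<bullet>\<^sub>4 (transpose F ** Z ** F)) ** transpose F)"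
proof -
  let ?C = "material_elasticity W (green_lagrange F)"
  have "?C \<bullet>\<^sub>4 (transpose F ** Z ** F) =
        (\<Sum>k\<in>UNIV. \<Sum>l\<in>UNIV. Z $ k $ l *\<^sub>R (?C \<bullet>\<^sub>4 pull_back_unit F k l))"
    unfolding sum_pull_back_unit[symmetric]
    by (simp add: linear_sum[OF linear_tensor_app] linear_scale[OF linear_tensor_app])
  then have "(F ** (?C \<bullet>\<^sub>4 (transpose F ** Z ** F)) ** transpose F) $ i $ j =
     (\<Sum>k\<in>UNIV. \<Sum>l\<in>UNIV. Z $ k $ l * ((?C \<bullet>\<^sub>4 pull_back_unit F k l) \<bullet> pull_back_unit F i j))" for i j
    by (simp add: inner_sum_left flip: inner_pull_back_unit)
  then show ?thesis
    by (simp add: vec_eq_iff tensor_app_def spatial_elasticity_inner sum_divide_distrib mult.commute)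
qed

text \<open>Exchanging the indices of a pair transposes a \<open>pull_back_unit\<close>, and
  exchanging the pairs swaps the arguments of the bilinear form; each symmetry is thus inherited
  from the material tensor.\<close>

lemma spatial_elasticity_symmetries:
  assumes W: "W differentiable_on strains" and S: "second_piola W differentiable_on strains"
    and F: "det F \<noteq> 0"
  shows "spatial_elasticity W F $ i $ j $ k $ l = spatial_elasticity W F $ j $ i $ k $ l"
    and "spatial_elasticity W F $ i $ j $ k $ l = spatial_elasticity W F $ i $ j $ l $ k"
    and "spatial_elasticity W F $ i $ j $ k $ l = spatial_elasticity W F $ k $ l $ i $ j"
proof -
  note E = green_lagrange_in_strains[OF F]
  let ?C = "material_elasticity W (green_lagrange F)"
  note C = material_elasticity[OF W S E]
  have "(?C \<bullet>\<^sub>4 X) \<bullet> transpose Y = (?C \<bullet>\<^sub>4 X) \<bullet> Y" for X Y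
    using tensor_app_in_Sym3[OF C(1), of X] by (simp add: Sym3_def flip: inner_transpose)
  then show "spatial_elasticity W F $ i $ j $ k $ l = spatial_elasticity W F $ j $ i $ k $ l"
    unfolding spatial_elasticity_inner by (metis transpose_pull_back_unit)
  show "spatial_elasticity W F $ i $ j $ k $ l = spatial_elasticity W F $ i $ j $ l $ k"
    unfolding spatial_elasticity_inner
    by (metis transpose_pull_back_unit tensor_app_transpose[OF C(2)])
  show "spatial_elasticity W F $ i $ j $ k $ l = spatial_elasticity W F $ k $ l $ i $ j"
    unfolding spatial_elasticity_inner using material_elasticity_symmetric[OF W S E] by simp
qed

section \<open>Symmetries of the tensor \<open>H_ZJ\<close>\<close>

lemma H_ZJ_nth:
  "H_ZJ W F $ i $ j $ k $ l =
     spatial_elasticity W F $ i $ j $ k $ l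
     + (1/2) * (kdelta i k * cauchy_stress W F $ j $ l + cauchy_stress W F $ i $ l * kdelta j k)
     + (1/2) * (cauchy_stress W F $ i $ k * kdelta j l + kdelta i l * cauchy_stress W F $ j $ k)
     - cauchy_stress W F $ i $ j * kdelta k l"
  by (simp add: H_ZJ_def sym_tensor_prod_def tensor_prod_def mat_def kdelta_def)

text \<open>The right-hand side is the major symmetry of
  \<open>tensor_prod \<sigma> (mat 1)\<close>.\<close>

lemma hydrostatic_iff:
  "hydrostatic \<sigma> \<longleftrightarrow> (\<forall>i j k l. \<sigma> $ i $ j * kdelta k l = \<sigma> $ k $ l * kdelta i j)"
proof
  assume "hydrostatic \<sigma>"
  then show "\<forall>i j k l. \<sigma> $ i $ j * kdelta k l = \<sigma> $ k $ l * kdelta i j"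
    by (auto simp: hydrostatic_def mat_def kdelta_def)
next
  assume *: "\<forall>i j k l. \<sigma> $ i $ j * kdelta k l = \<sigma> $ k $ l * kdelta i j"
  define p where "p = \<sigma> $ 1 $ 1"
  have "\<sigma> $ i $ j = p * kdelta i j" for i j
    \<comment> \<open>With \<open>k = l = 1\<close> the left delta is 1 and the stress on the right
      is \<open>p\<close>.\<close>
    using *[rule_format, of i j 1 1] by (simp add: kdelta_def p_def)
  then have "\<sigma> = p *\<^sub>R mat 1"
    by (simp add: vec_eq_iff mat_def kdelta_def)
  then show "hydrostatic \<sigma>" unfolding hydrostatic_def ..
qed

lemma kdelta_commute: "kdelta i j = kdelta j i"
  by (simp add: kdelta_def)

text \<open>Exchanging \<open>i\<close> and \<open>j\<close> permutes the summands within each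
  symmetric product; exchanging \<open>k\<close> and \<open>l\<close> swaps the two products with
  each other. The last term is handled by the symmetry of the stress and of the identity.\<close>

lemma H_ZJ_minor_symmetric:
  assumes W: "W differentiable_on strains" and S: "second_piola W differentiable_on strains"
    and F: "det F \<noteq> 0"
  shows "left_minor_symmetric (H_ZJ W F)" and "right_minor_symmetric (H_ZJ W F)"
proof -
  note c = spatial_elasticity_symmetries[OF W S F]
  note s = Sym3_nth[OF cauchy_stress_in_Sym3[OF W F]]
  have "H_ZJ W F $ i $ j $ k $ l = H_ZJ W F $ j $ i $ k $ l" for i j k l
    unfolding H_ZJ_nth c(1)[of i j k l] s[of i j] by (simp add: algebra_simps)
  then show "left_minor_symmetric (H_ZJ W F)" unfolding left_minor_symmetric_def by blast
  have "H_ZJ W F $ i $ j $ k $ l = H_ZJ W F $ i $ j $ l $ k" for i j k l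
    unfolding H_ZJ_nth c(2)[of i j k l] kdelta_commute[of k l] by (simp add: algebra_simps)
  then show "right_minor_symmetric (H_ZJ W F)" unfolding right_minor_symmetric_def by blast
qed

text \<open>The spatial tensor and, for symmetric stress, the sum of the two symmetric products are
  major symmetric, so only the last term contributes to the defect.\<close>

lemma H_ZJ_major_symmetric_iff:
  assumes W: "W differentiable_on strains" and S: "second_piola W differentiable_on strains"
    and F: "det F \<noteq> 0"
  shows "major_symmetric (H_ZJ W F) \<longleftrightarrow> hydrostatic (cauchy_stress W F)"
proof -
  note s = Sym3_nth[OF cauchy_stress_in_Sym3[OF W F]]
  have "H_ZJ W F $ i $ j $ k $ l - H_ZJ W F $ k $ l $ i $ j =
      cauchy_stress W F $ k $ l * kdelta i j - cauchy_stress W F $ i $ j * kdelta k l" for i j k l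
    unfolding H_ZJ_nth
      spatial_elasticity_symmetries(3)[OF W S F, of i j k l] s[of k i] s[of k j] s[of l i] s[of l j]
      kdelta_commute[of k i] kdelta_commute[of k j] kdelta_commute[of l i] kdelta_commute[of l j]
    by (simp add: algebra_simps)
  then have "H_ZJ W F $ i $ j $ k $ l = H_ZJ W F $ k $ l $ i $ j \<longleftrightarrow>
      cauchy_stress W F $ i $ j * kdelta k l = cauchy_stress W F $ k $ l * kdelta i j" for i j k l
    by (metis eq_iff_diff_eq_0)
  then show ?thesis unfolding major_symmetric_def hydrostatic_iff by simp
qed

subsection \<open>Rates along a motion\<close>

lemma matrix_mult_scaleR:
  fixes A :: "real^'n^'m" and B :: "real^'k^'n"
  shows "(c *\<^sub>R A) ** B = c *\<^sub>R (A ** B)" "A ** (c *\<^sub>R B) = c *\<^sub>R (A ** B)"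
  by (simp_all add: scalar_matrix_assoc matrix_scalar_ac)

lemma matrix_mult_add_rdistrib:
  fixes A B :: "real^'n^'m" and C :: "real^'k^'n"
  shows "(A + B) ** C = A ** C + B ** C"
  by (simp add: vec_eq_iff matrix_matrix_mult_def algebra_simps sum.distrib)

lemma bounded_bilinear_matrix_mult:
  "bounded_bilinear ((**) :: real^'n^'m \<Rightarrow> real^'k^'n \<Rightarrow> real^'k^'m)"
  by (auto simp: bilinear_def matrix_add_ldistrib matrix_mult_scaleR matrix_mult_add_rdistrib
      simp flip: bilinear_conv_bounded_bilinear intro!: linearI)

lemmas has_vector_derivative_matrix_mult =
  bounded_bilinear.has_vector_derivative[OF bounded_bilinear_matrix_mult]

lemma bounded_linear_transpose: "bounded_linear (transpose :: real^'n^'m \<Rightarrow> real^'m^'n)"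
  by (auto simp: transpose_simps simp flip: linear_conv_bounded_linear intro!: linearI)

lemmas has_vector_derivative_transpose = bounded_linear.has_vector_derivative[OF bounded_linear_transpose]

text \<open>Jacobi's formula: with the derivative written as \<open>L ** F t\<close>, the cofactor
  expression collapses to a trace, here by expanding the 3x3 determinant.\<close>

lemma has_real_derivative_det:
  fixes F :: "real \<Rightarrow> mat3"
  assumes F: "(F has_vector_derivative L ** F t) (at t within I)"
  shows "((\<lambda>s. det (F s)) has_real_derivative trace L * det (F t)) (at t within I)"
proof -
  have nth: "((\<lambda>s. F s $ i $ j) has_real_derivative (\<Sum>k\<in>UNIV. L $ i $ k * F t $ k $ j)) (at t within I)" for i j
    using bounded_linear.has_vector_derivative[OF bounded_linear_vec_nth
        bounded_linear.has_vector_derivative[OF bounded_linear_vec_nth F, of i], of j]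
    by (simp add: has_real_derivative_iff_has_vector_derivative matrix_mult_nth)
  show ?thesis
    unfolding det_3
    by (rule derivative_eq_intros nth refl)+ (simp add: trace_def sum_3 algebra_simps)
qed

text \<open>The right-hand side is the symmetric part of
  \<open>P ** Z ** transpose Q\<close>.\<close>

lemma sym_tensor_prod_app:
  "sym_tensor_prod P Q \<bullet>\<^sub>4 Z = (1/2) *\<^sub>R (P ** Z ** transpose Q + Q ** transpose Z ** transpose P)"
  by (simp add: vec_eq_iff sym_tensor_prod_def tensor_app_def matrix_mult_nth transpose_nth sum_3
      algebra_simps add_divide_distrib)

lemma tensor_prod_app: "tensor_prod P Q \<bullet>\<^sub>4 Z = (Q \<bullet> Z) *\<^sub>R P"
  by (simp add: vec_eq_iff tensor_prod_def tensor_app_def inner_matrix_eq sum_distrib_left mult_ac)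

lemma inner_mat_1: "mat 1 \<bullet> Z = trace Z" for Z :: "real^'n^'n"
  by (simp add: inner_matrix_eq mat_def trace_def if_distrib[where f = "\<lambda>x. x * _"] cong: if_cong)

lemma tensor_app_add: "(T + T') \<bullet>\<^sub>4 Z = T \<bullet>\<^sub>4 Z + T' \<bullet>\<^sub>4 Z"
  and tensor_app_diff: "(T - T') \<bullet>\<^sub>4 Z = T \<bullet>\<^sub>4 Z - T' \<bullet>\<^sub>4 Z"
  by (simp_all add: vec_eq_iff tensor_app_def algebra_simps sum.distrib sum_subtractf)

text \<open>For symmetric stress and \<open>D\<close> each symmetric product contributes one half of
  the anticommutator.\<close>

lemma H_ZJ_app:
  assumes \<sigma>: "cauchy_stress W F \<in> Sym3" and D: "D \<in> Sym3"
  shows "H_ZJ W F \<bullet>\<^sub>4 D = spatial_elasticity W F \<bullet>\<^sub>4 D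
     + D ** cauchy_stress W F + cauchy_stress W F ** D - trace D *\<^sub>R cauchy_stress W F"
proof -
  have a: "sym_tensor_prod (mat 1) (cauchy_stress W F) \<bullet>\<^sub>4 D =
          (1/2) *\<^sub>R (D ** cauchy_stress W F + cauchy_stress W F ** D)"
    and b: "sym_tensor_prod (cauchy_stress W F) (mat 1) \<bullet>\<^sub>4 D =
          (1/2) *\<^sub>R (cauchy_stress W F ** D + D ** cauchy_stress W F)"
    using \<sigma> D by (simp_all add: sym_tensor_prod_app Sym3_def transpose_mat)
  show ?thesis
    unfolding H_ZJ_def tensor_app_add tensor_app_diff tensor_prod_app inner_mat_1 a b
    by (simp add: vec_eq_iff field_simps)
qed

text \<open>A connected set with more than one point has no isolated points. Hence
  \<open>vector_derivative\<close> within \<open>I\<close> is unique, also at end points.\<close>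

lemma motion_on_islimpt:
  assumes "motion_on I F" "t \<in> I"
  shows "t islimpt I"
proof (rule connected_imp_perfect)
  show "connected I" using assms by (simp add: motion_on_def is_interval_connected)
  have "interior I \<noteq> {}" using assms by (simp add: motion_on_def)
  then show "I \<noteq> {x}" for x by auto
qed (rule assms)

lemma motion_on_velocity_gradient:
  assumes F: "motion_on I F" and t: "t \<in> I"
  shows "(F has_vector_derivative velocity_gradient I F t ** F t) (at t within I)"
proof -
  obtain F' where F': "(F has_vector_derivative F' t) (at t within I)"
    using F t unfolding motion_on_def by blast
  have "det (F t) \<noteq> 0" using F t unfolding motion_on_def by force
  then have "matrix_inv (F t) ** F t = mat 1"
    unfolding invertible_det_nz[symmetric] invertible_def matrix_inv_def by (rule someI2_ex) blast
  moreover have "vector_derivative F (at t within I) = F' t"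
    using motion_on_islimpt[OF F t] F'
    by (intro vector_derivative_within) (simp_all add: trivial_limit_within)
  ultimately show ?thesis using F'
    by (simp add: velocity_gradient_def flip: matrix_mul_assoc)
qed

text \<open>The strain rate is the pull-back of the stretching, whence the spatial tensor acts on
  the stretching in the stress rate.\<close>

lemma has_vector_derivative_green_lagrange:
  assumes F: "(F has_vector_derivative L ** F t) (at t within I)"
  shows "((\<lambda>s. green_lagrange (F s)) has_vector_derivative
            transpose (F t) ** ((1/2) *\<^sub>R (L + transpose L)) ** F t) (at t within I)"
proof -
  have "((\<lambda>s. (1/2) *\<^sub>R (transpose (F s) ** F s - mat 1)) has_vector_derivative
      (1/2) *\<^sub>R ((transpose (F t) ** (L ** F t) + transpose (L ** F t) ** F t) - 0)) (at t within I)"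
    by (intro bounded_linear.has_vector_derivative[OF bounded_linear_scaleR_right]
        has_vector_derivative_diff has_vector_derivative_matrix_mult has_vector_derivative_transpose
        has_vector_derivative_const F)
  then show ?thesis
    by (simp add: green_lagrange_def matrix_transpose_mul matrix_mul_assoc matrix_mult_scaleR
        matrix_add_ldistrib matrix_mult_add_rdistrib)
qed

lemma has_vector_derivative_cauchy_stress:
  assumes W: "W differentiable_on strains" and S: "second_piola W differentiable_on strains"
    and F: "(F has_vector_derivative L ** F t) (at t within I)"
    and J: "\<And>s. s \<in> I \<Longrightarrow> det (F s) \<noteq> 0" and t: "t \<in> I"
  defines "\<sigma> \<equiv> cauchy_stress W (F t)"
  shows "((\<lambda>s. cauchy_stress W (F s)) has_vector_derivative
     spatial_elasticity W (F t) \<bullet>\<^sub>4 ((1/2) *\<^sub>R (L + transpose L))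
       + L ** \<sigma> + \<sigma> ** transpose L - trace L *\<^sub>R \<sigma>) (at t within I)"
proof -
  define D where "D = (1/2) *\<^sub>R (L + transpose L)"
  let ?E = "\<lambda>s. green_lagrange (F s)"
  let ?S = "\<lambda>s. second_piola W (?E s)"
  define P where "P = material_elasticity W (?E t) \<bullet>\<^sub>4 (transpose (F t) ** D ** F t)"
  have E: "?E s \<in> strains" if "s \<in> I" for s using green_lagrange_in_strains J that by blast
  have dS: "(?S has_vector_derivative P) (at t within I)"
  proof -
    \<comment> \<open>The stress is differentiated within \<open>strains\<close>, so the chain rule
      needs the strain curve to remain there.\<close>
    have sub: "?E ` I \<subseteq> strains" using E by blast
    have "(?S has_derivative (\<lambda>v. material_elasticity W (?E t) \<bullet>\<^sub>4 (v *\<^sub>R (transpose (F t) ** D ** F t))))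
            (at t within I)"
      using has_vector_derivative_green_lagrange[OF F]
        has_derivative_subset[OF material_elasticity(3)[OF W S E[OF t]] sub]
      unfolding has_vector_derivative_def D_def by (rule has_derivative_in_compose)
    then show ?thesis
      by (simp add: has_vector_derivative_def P_def linear_scale[OF linear_tensor_app])
  qed
  have dJ: "((\<lambda>s. 1 / det (F s)) has_real_derivative - trace L / det (F t)) (at t within I)"
    using J[OF t] by (auto intro!: derivative_eq_intros has_real_derivative_det[OF F] simp: power2_eq_square)
  have "((\<lambda>s. (1 / det (F s)) *\<^sub>R (F s ** ?S s ** transpose (F s))) has_vector_derivative
     (1 / det (F t)) *\<^sub>R ((F t ** ?S t) ** transpose (L ** F t) + (F t ** P + (L ** F t) ** ?S t) ** transpose (F t))
     + (- trace L / det (F t)) *\<^sub>R (F t ** ?S t ** transpose (F t))) (at t within I)"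
    by (intro has_vector_derivative_scaleR has_vector_derivative_matrix_mult
        has_vector_derivative_transpose F dS dJ)
  \<comment> \<open>The term with \<open>P\<close> becomes the action of the spatial tensor; the
    remaining terms of the product rule regroup around \<sigma>.\<close>
  moreover have "(1 / det (F t)) *\<^sub>R ((F t ** ?S t) ** transpose (L ** F t) + (F t ** P + (L ** F t) ** ?S t) ** transpose (F t))
     + (- trace L / det (F t)) *\<^sub>R (F t ** ?S t ** transpose (F t))
     = spatial_elasticity W (F t) \<bullet>\<^sub>4 D + L ** \<sigma> + \<sigma> ** transpose L - trace L *\<^sub>R \<sigma>"
    by (simp add: spatial_elasticity_app P_def[symmetric] \<sigma>_def cauchy_stress_def matrix_transpose_mul
        matrix_mul_assoc matrix_mult_scaleR matrix_mult_add_rdistrib scaleR_add_right)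
  ultimately show ?thesis by (simp add: cauchy_stress_def D_def)
qed

text \<open>Differentiability is included because \<open>vector_derivative\<close> is a total
  function; it ensures that \<open>ZJ_rate\<close> contains a genuine derivative.\<close>

lemma ZJ_rate_cauchy_stress:
  assumes W: "W differentiable_on strains" and S: "second_piola W differentiable_on strains"
    and F: "motion_on I F" and t: "t \<in> I"
  shows "(\<lambda>s. cauchy_stress W (F s)) differentiable (at t within I)"
    and "ZJ_rate I F (\<lambda>s. cauchy_stress W (F s)) t = H_ZJ W (F t) \<bullet>\<^sub>4 stretching I F t"
proof -
  define L where "L = velocity_gradient I F t"
  define \<sigma> where "\<sigma> = cauchy_stress W (F t)"
  have J: "det (F s) \<noteq> 0" if "s \<in> I" for s
    using F that unfolding motion_on_def by force
  note d = has_vector_derivative_cauchy_stress[OF W S motion_on_velocity_gradient[OF F t] J t,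
      folded L_def \<sigma>_def]
  from d show "(\<lambda>s. cauchy_stress W (F s)) differentiable (at t within I)"
    by (auto simp: has_vector_derivative_def differentiable_def)
  have "at t within I \<noteq> bot"
    using motion_on_islimpt[OF F t] by (simp add: trivial_limit_within)
  note vd = vector_derivative_within[OF this d]
  have D: "stretching I F t = (1/2) *\<^sub>R (L + transpose L)"
    and Wsp: "spin I F t = (1/2) *\<^sub>R (L - transpose L)"
    by (simp_all add: stretching_def spin_def L_def)
  have "stretching I F t \<in> Sym3"
    unfolding D by (simp add: Sym3_def transpose_simps add.commute)
  note H = H_ZJ_app[OF cauchy_stress_in_Sym3[OF W J[OF t]] this, folded \<sigma>_def]
  have tr: "trace (stretching I F t) = trace L"
    by (simp add: D trace_def transpose_def sum_divide_distrib)
  \<comment> \<open>\<open>L\<close> is stretching plus spin and its transpose is stretching minus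
    spin, so the spin terms cancel against the corotational correction.\<close>
  have "L ** \<sigma> + \<sigma> ** transpose L + \<sigma> ** spin I F t
      = stretching I F t ** \<sigma> + \<sigma> ** stretching I F t + spin I F t ** \<sigma>"
    unfolding D Wsp
    by (simp add: vec_eq_iff matrix_mult_nth transpose_nth sum_3 field_simps)
  with vd[folded D] show "ZJ_rate I F (\<lambda>s. cauchy_stress W (F s)) t = H_ZJ W (F t) \<bullet>\<^sub>4 stretching I F t"
    unfolding ZJ_rate_def H tr \<sigma>_def[symmetric]
    by (simp add: diff_eq_eq diff_add_eq add.assoc)
qed

text \<open>The algebraic claims are stated for every \<open>F\<close> of positive determinant, and
  the major symmetry as an equivalence, which includes its presence for hydrostatic stress.\<close>

theorem mainTheorem3:
  fixes W :: "real^3^3 \<Rightarrow> real"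
  assumes "C2_energy W"
  shows "(\<forall>I F. motion_on I F \<longrightarrow>
           (\<forall>t\<in>I. (\<lambda>s. cauchy_stress W (F s)) differentiable (at t within I) \<and>
                  ZJ_rate I F (\<lambda>s. cauchy_stress W (F s)) t
                    = H_ZJ W (F t) \<bullet>\<^sub>4 stretching I F t)) \<and>
         (\<forall>F. det F > 0 \<longrightarrow>
           (\<forall>i j k l. H_ZJ W F $ i $ j $ k $ l =
              spatial_elasticity W F $ i $ j $ k $ l
              + (1/2) * (kdelta i k * cauchy_stress W F $ j $ l
                         + cauchy_stress W F $ i $ l * kdelta j k)
              + (1/2) * (cauchy_stress W F $ i $ k * kdelta j l
                         + kdelta i l * cauchy_stress W F $ j $ k)
              - cauchy_stress W F $ i $ j * kdelta k l)) \<and>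
         (\<forall>F. det F > 0 \<longrightarrow>
           left_minor_symmetric (H_ZJ W F) \<and> right_minor_symmetric (H_ZJ W F) \<and>
           (major_symmetric (H_ZJ W F) \<longleftrightarrow> hydrostatic (cauchy_stress W F)))"
proof -
  have W: "W differentiable_on strains" and S: "second_piola W differentiable_on strains"
    using assms by (auto simp: C2_energy_def)
  have nz: "det F \<noteq> 0" if "det F > 0" for F :: mat3 using that by simp
  show ?thesis
    by (intro conjI allI ballI impI ZJ_rate_cauchy_stress[OF W S] H_ZJ_nth
        H_ZJ_minor_symmetric[OF W S nz] H_ZJ_major_symmetric_iff[OF W S nz])
qed

end
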